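(* Consider the exponential family model described in the context, with scale parameter $\gamma>0$ known. Define, for $\mathbf{d}\in\mathcal{D}$, $$\phi(\mathbf{d}) = \sum_{j=1}^p \mathrm{E}_{\boldsymbol{\theta}}\left[\frac{1}{\mathrm{var}_{y\vert\boldsymbol{\theta},\mathbf{d}}(y)}\left(\frac{\partial\mu(\boldsymbol{\theta},\mathbf{d})}{\partial\theta_j}\right)^2\right],$$ where the expectation is with respect to the prior distribution of $\boldsymbol{\theta}$. Then the design points of the FIG-optimal designs are given by the maximisers of $\phi$ over $\mathcal{D}$; that is, a design $\tilde{\mathbf{D}}=(\tilde{\mathbf{d}}_1^{T},\dots,\tilde{\mathbf{d}}_n^{T})^{T}\in\mathcal{D}^n$ maximises the expected Fisher information gain $U_{FIG}$ over $\mathcal{D}^n$ if and only if, for each $i=1,\dots,n$, $\tilde{\mathbf{d}}_i$ is a global maximiser of $\phi$ over $\mathcal{D}$.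
   Context: There are $k$ controllable variables $\mathbf{d}=(d_1,\dots,d_k)^{T}\in\mathcal{D}\subseteq\mathbb{R}^k$. An experiment has a fixed number $n$ of runs; run $i$ uses $\mathbf{d}_i\in\mathcal{D}$ (a design point) and yields a response $y_i$. The design is $\mathbf{D}=(\mathbf{d}_1^{T},\dots,\mathbf{d}_n^{T})^{T}\in\mathcal{D}^n$ and $\mathbf{y}=(y_1,\dots,y_n)^{T}$. The unknown parameter vector is $\boldsymbol{\theta}=(\theta_1,\dots,\theta_p)^{T}\in\Theta$, with $\Theta$ a $p$-dimensional parameter space, $p\le n$, and it has a prior distribution not depending on $\mathbf{D}$. Exponential family model: given the parameters, $y_1,\dots,y_n$ are independent and $y_i$ has pdf or mass function $$\pi(y_i\vert\zeta_i,\gamma)=\exp\left(\frac{y_i\zeta_i-b(\zeta_i)-c_1(y_i)}{\gamma}-\frac12 a\left(-\frac1\gamma\right)+c_2(y_i)\right),$$ where $a,b,c_1,c_2$ are sufficiently smooth specified functions, $\gamma>0$ is a common scale parameter, and the natural parameter $\zeta_i$ depends on $\boldsymbol{\theta}$ and $\mathbf{d}_i$ through $b'(\zeta_i)=\mathrm{E}(y_i)=\mu(\boldsymbol{\theta},\mathbf{d}_i)$, with $\mu$ a given mean function, differentiable in $\boldsymbol{\theta}$; moreover $\mathrm{var}(y_i)=\gamma b''(\zeta_i)>0$. Write $\mathrm{var}_{y\vert\boldsymbol{\theta},\mathbf{d}}(y)$ for the variance of a response $y$ with controllable variables $\mathbf{d}$ and parameters $\boldsymbol{\theta}$. The Fisher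 information matrix is the $p\times p$ matrix $\mathcal{I}(\boldsymbol{\theta},\mathbf{D})=\mathrm{E}_{\mathbf{y}\vert\boldsymbol{\theta},\mathbf{D}}\left[\frac{\partial\log\pi(\mathbf{y}\vert\boldsymbol{\theta},\mathbf{D})}{\partial\boldsymbol{\theta}}\frac{\partial\log\pi(\mathbf{y}\vert\boldsymbol{\theta},\mathbf{D})}{\partial\boldsymbol{\theta}^{T}}\right]$. For this model with $\gamma$ known it is (a known fact) $\mathcal{I}(\boldsymbol{\theta},\mathbf{D})=M^{T}WM$, where $M$ is the $n\times p$ matrix with entries $M_{ij}=\partial\mu(\boldsymbol{\theta},\mathbf{d}_i)/\partial\theta_j$ and $W$ is the $n\times n$ diagonal matrix with $W_{ii}=1/\mathrm{var}_{y_i\vert\boldsymbol{\theta},\mathbf{d}_i}(y_i)$. The expected Fisher information gain (FIG) is $U_{FIG}(\mathbf{D})=\mathrm{E}_{\boldsymbol{\theta}}[\mathrm{tr}\,\mathcal{I}(\boldsymbol{\theta},\mathbf{D})]$, the expectation being over the prior; standard regularity conditions are assumed, and the Fisher information and this expectation are assumed to exist (be finite) for all designs. A design is FIG-optimal if it maximises $U_{FIG}$ over $\mathcal{D}^n$. *)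

theory Defs
  imports "HOL-Probability.Probability"
begin

text \<open>
  The dominating measure of a single real response: Lebesgue measure on a Borel support when the
  response has a pdf, counting measure on a countable support when it has a mass function.  The
  support is the space of the measure, because the exponential family formula itself never vanishes.
\<close>

definition response_base :: "real measure \<Rightarrow> bool" where
  "response_base \<nu> \<longleftrightarrow>
     (\<exists>S\<in>sets borel. \<nu> = restrict_space lborel S) \<or> (\<exists>S. countable S \<and> \<nu> = count_space S)"

definition expfam_density ::
  "(real \<Rightarrow> real) \<Rightarrow> (real \<Rightarrow> real) \<Rightarrow> (real \<Rightarrow> real) \<Rightarrow> (real \<Rightarrow> real) \<Rightarrow> real \<Rightarrow> real \<Rightarrow> real \<Rightarrow> real" where
  "expfam_density a b c1 c2 \<gamma> z y =
     exp ((y * z - b z - c1 y) / \<gamma> - 1 / 2 * a (- 1 / \<gamma>) + c2 y)"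

definition law :: "real measure \<Rightarrow> (real \<Rightarrow> real) \<Rightarrow> real measure" where
  "law \<nu> g = density \<nu> (\<lambda>y. ennreal (g y))"

definition partial_deriv :: "'p::finite \<Rightarrow> (real ^ 'p \<Rightarrow> real) \<Rightarrow> real ^ 'p \<Rightarrow> real" where
  "partial_deriv j g \<theta> = deriv (\<lambda>t. g (\<theta> + t *\<^sub>R axis j 1)) 0"

text \<open>
  A design is an \<open>n \<times> k\<close> matrix whose rows are the design points.  Below, \<open>f \<theta> d\<close> is the density
  (with respect to \<open>\<nu>\<close>) of a response with parameters \<open>\<theta>\<close> and controllable variables \<open>d\<close>.
\<close>

definition designs :: "(real ^ 'k) set \<Rightarrow> (real ^ 'k ^ 'n) set" where
  "designs \<D> = {D. \<forall>i. D $ i \<in> \<D>}"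

definition joint_density ::
  "(real ^ 'p \<Rightarrow> real ^ 'k \<Rightarrow> real \<Rightarrow> real) \<Rightarrow> real ^ 'p \<Rightarrow> real ^ 'k ^ 'n::finite \<Rightarrow> ('n \<Rightarrow> real) \<Rightarrow> real" where
  "joint_density f \<theta> D y = (\<Prod>i\<in>UNIV. f \<theta> (D $ i) (y i))"

text \<open>The product measure expresses that the responses are independent given the parameters.\<close>

definition joint_law ::
  "real measure \<Rightarrow> (real ^ 'p \<Rightarrow> real ^ 'k \<Rightarrow> real \<Rightarrow> real) \<Rightarrow> real ^ 'p \<Rightarrow> real ^ 'k ^ 'n::finite
    \<Rightarrow> ('n \<Rightarrow> real) measure" where
  "joint_law \<nu> f \<theta> D = Pi\<^sub>M UNIV (\<lambda>i. law \<nu> (f \<theta> (D $ i)))"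

definition score ::
  "(real ^ 'p \<Rightarrow> real ^ 'k \<Rightarrow> real \<Rightarrow> real) \<Rightarrow> real ^ 'p::finite \<Rightarrow> real ^ 'k ^ 'n::finite
    \<Rightarrow> ('n \<Rightarrow> real) \<Rightarrow> real ^ 'p" where
  "score f \<theta> D y = (\<chi> j. partial_deriv j (\<lambda>t. ln (joint_density f t D y)) \<theta>)"

definition fisher_info ::
  "real measure \<Rightarrow> (real ^ 'p \<Rightarrow> real ^ 'k \<Rightarrow> real \<Rightarrow> real) \<Rightarrow> real ^ 'p::finite \<Rightarrow> real ^ 'k ^ 'n::finite
    \<Rightarrow> real ^ 'p ^ 'p" where
  "fisher_info \<nu> f \<theta> D =
     (\<chi> j l. \<integral>y. score f \<theta> D y $ j * score f \<theta> D y $ l \<partial>joint_law \<nu> f \<theta> D)"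

definition U_FIG ::
  "(real ^ 'p) measure \<Rightarrow> real measure \<Rightarrow> (real ^ 'p \<Rightarrow> real ^ 'k \<Rightarrow> real \<Rightarrow> real)
    \<Rightarrow> real ^ 'k ^ 'n::finite \<Rightarrow> real" where
  "U_FIG prior \<nu> f D = (\<integral>\<theta>. trace (fisher_info \<nu> f \<theta> D) \<partial>prior)"

definition FIG_optimal ::
  "(real ^ 'p) measure \<Rightarrow> real measure \<Rightarrow> (real ^ 'p \<Rightarrow> real ^ 'k \<Rightarrow> real \<Rightarrow> real)
    \<Rightarrow> (real ^ 'k) set \<Rightarrow> real ^ 'k ^ 'n::finite \<Rightarrow> bool" where
  "FIG_optimal prior \<nu> f \<D> D \<longleftrightarrow> is_arg_max (U_FIG prior \<nu> f) (\<lambda>D'. D' \<in> designs \<D>) D"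

definition FIG_phi ::
  "(real ^ 'p) measure \<Rightarrow> real measure \<Rightarrow> (real ^ 'p \<Rightarrow> real ^ 'k \<Rightarrow> real \<Rightarrow> real)
    \<Rightarrow> (real ^ 'p::finite \<Rightarrow> real ^ 'k \<Rightarrow> real) \<Rightarrow> real ^ 'k \<Rightarrow> real" where
  "FIG_phi prior \<nu> f \<mu> d =
     (\<Sum>j\<in>UNIV. \<integral>\<theta>. 1 / prob_space.variance (law \<nu> (f \<theta> d)) (\<lambda>y. y)
        * (partial_deriv j (\<lambda>t. \<mu> t d) \<theta>)\<^sup>2 \<partial>prior)"

end

theory Submission
  imports Defs
begin

text \<open>
  The expected information gain is a sum of contributions of the single runs, namely
  \<open>U_FIG D = (\<Sum>i. \<phi> (D $ i))\<close>, and \<open>D $ i\<close> ranges over \<open>\<D>\<close> independently of the other rows. Such a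
  sum is maximal exactly when each of its summands is (\<open>is_arg_max_sum_iff\<close>).

  The decomposition rests on the independence of the responses. The score is linear in the residuals
  \<open>y\<^sub>i - \<mu>\<^sub>i\<close>: differentiating the log-likelihood gives \<open>(y\<^sub>i - \<mu>\<^sub>i) \<partial>\<^sub>j\<zeta>\<^sub>i / \<gamma>\<close> for each run, where
  \<open>b' \<zeta>\<^sub>i = \<mu>\<^sub>i\<close> and \<open>b'' > 0\<close> make \<open>\<zeta>\<^sub>i\<close> a differentiable function of the parameters with
  \<open>\<partial>\<^sub>j\<zeta>\<^sub>i = \<partial>\<^sub>j\<mu>\<^sub>i / b'' \<zeta>\<^sub>i\<close> (\<open>score_eq\<close>). The residuals are independent with mean zero, so the second
  moment of the score has no mixed terms (\<open>PiM_integral_square_sum\<close>) and the trace of the information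
  matrix is the sum over all \<open>i\<close> and \<open>j\<close> of \<open>(\<partial>\<^sub>j\<mu>\<^sub>i)\<^sup>2\<close> divided by the variance of the response
  (\<open>trace_fisher_info\<close>).

  It remains to exchange the prior expectation with this double sum. The hypotheses only bound the
  trace for each design, so each summand has to be shown integrable by itself. It is nonnegative and
  bounded by the trace for the design that repeats one point in all runs, and it is measurable because
  derivatives are limits of difference quotients (\<open>borel_measurable_directional_deriv\<close>).
\<close>

section \<open>Maximising a sum with one summand per design point\<close>

text \<open>
  Only one coordinate has to be changed at a time: if some coordinate of a maximiser of the sum could
  be improved, replacing it alone would improve the sum, because the other summands do not see it.
\<close>

lemma is_arg_max_sum_iff:
  fixes \<phi> :: "'a \<Rightarrow> real" and D :: "'a ^ 'n"
  assumes split: "\<And>E. (\<forall>i. E $ i \<in> A) \<Longrightarrow> U E = (\<Sum>i\<in>UNIV. \<phi> (E $ i))"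
    and D: "\<forall>i. D $ i \<in> A"
  shows "is_arg_max U (\<lambda>E. \<forall>i. E $ i \<in> A) D \<longleftrightarrow> (\<forall>i. is_arg_max \<phi> (\<lambda>d. d \<in> A) (D $ i))"
proof
  assume opt: "is_arg_max U (\<lambda>E. \<forall>i. E $ i \<in> A) D"
  show "\<forall>i. is_arg_max \<phi> (\<lambda>d. d \<in> A) (D $ i)"
    unfolding is_arg_max_linorder
  proof (intro allI conjI impI)
    fix i d assume d: "d \<in> A"
    define E where "E = (\<chi> k. if k = i then d else D $ k)"
    have E: "\<forall>k. E $ k \<in> A" using D d by (simp add: E_def)
    have "(\<Sum>k\<in>UNIV. \<phi> (E $ k)) \<le> (\<Sum>k\<in>UNIV. \<phi> (D $ k))"
      using opt E split[OF E] split[OF D] by (auto simp: is_arg_max_linorder)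
    moreover have "(\<Sum>k\<in>UNIV. \<phi> (E $ k)) = \<phi> d + (\<Sum>k\<in>UNIV - {i}. \<phi> (D $ k))"
      by (subst sum.remove[of _ i]) (auto simp: E_def intro!: sum.cong)
    moreover have "(\<Sum>k\<in>UNIV. \<phi> (D $ k)) = \<phi> (D $ i) + (\<Sum>k\<in>UNIV - {i}. \<phi> (D $ k))"
      by (rule sum.remove) auto
    ultimately show "\<phi> d \<le> \<phi> (D $ i)" by simp
  qed (use D in auto)
next
  assume "\<forall>i. is_arg_max \<phi> (\<lambda>d. d \<in> A) (D $ i)"
  then show "is_arg_max U (\<lambda>E. \<forall>i. E $ i \<in> A) D"
    using D by (auto simp: is_arg_max_linorder split intro!: sum_mono)
qed

section \<open>The law of a response\<close>

text \<open>
  The model prescribes the density on the support of the response only; this lets the laws of the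
  responses be identified with laws of the family.
\<close>

lemma law_cong: "(\<And>y. y \<in> space \<nu> \<Longrightarrow> g y = h y) \<Longrightarrow> law \<nu> g = law \<nu> h"
  unfolding law_def density_def
  by (intro arg_cong[where f = "measure_of _ _"] ext nn_integral_cong) simp

lemma response_base_measurable_id: "response_base \<nu> \<Longrightarrow> (\<lambda>y. y) \<in> borel_measurable \<nu>"
  by (auto simp: response_base_def intro: measurable_restrict_space1)

lemma space_law [simp]: "space (law \<nu> g) = space \<nu>"
  and sets_law [measurable_cong]: "sets (law \<nu> g) = sets \<nu>"
  by (simp_all add: law_def)

section \<open>Second moments of sums of independent centred variables\<close>

text \<open>
  The product of two coordinate functions is a product over all coordinates whose other factors are
  the constant 1, so Fubini's theorem for finite products turns its integral into a product of
  integrals. For two different coordinates one of these is the vanishing mean.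
\<close>

lemma PiM_integral_pair:
  fixes X :: "'i::finite \<Rightarrow> 'a \<Rightarrow> real" and M :: "'i \<Rightarrow> 'a measure"
  assumes prob: "\<And>i. prob_space (M i)"
    and int: "\<And>i. integrable (M i) (X i)"
    and sq: "\<And>i. integrable (M i) (\<lambda>x. (X i x)\<^sup>2)"
    and zero: "\<And>i. (\<integral>x. X i x \<partial>M i) = 0"
  shows "integrable (Pi\<^sub>M UNIV M) (\<lambda>y. X i (y i) * X k (y k))"
    and "(\<integral>y. X i (y i) * X k (y k) \<partial>Pi\<^sub>M UNIV M) = (if i = k then \<integral>x. (X i x)\<^sup>2 \<partial>M i else 0)"
proof -
  interpret prob_space "M i" for i by (rule prob)
  interpret product_sigma_finite M ..
  \<comment> \<open>This form of the factors covers both cases: for \<open>i = k\<close> the factor at \<open>i\<close> is the square.\<close>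
  define F where "F r x = (if r = i then X r x else 1) * (if r = k then X r x else 1)" for r x
  have F_cases: "F r = (if r = i then if r = k then \<lambda>x. (X r x)\<^sup>2 else X r else if r = k then X r else (\<lambda>_. 1))" for r
    by (auto simp: F_def power2_eq_square fun_eq_iff)
  have F_int: "integrable (M r) (F r)" for r
    using int[of r] sq[of r] by (auto simp: F_cases)
  have prod_F: "(\<Prod>r\<in>UNIV. F r (y r)) = X i (y i) * X k (y k)" for y
    by (simp add: F_def prod.distrib prod.delta)
  show "integrable (Pi\<^sub>M UNIV M) (\<lambda>y. X i (y i) * X k (y k))"
    using product_integrable_prod[OF finite F_int, where I = UNIV] by (simp add: prod_F)
  have "(\<integral>y. X i (y i) * X k (y k) \<partial>Pi\<^sub>M UNIV M) = (\<Prod>r\<in>UNIV. integral\<^sup>L (M r) (F r))"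
    using product_integral_prod[OF finite F_int, where I = UNIV] by (simp add: prod_F)
  also have "\<dots> = (if i = k then \<integral>x. (X i x)\<^sup>2 \<partial>M i else 0)"
  proof (cases "i = k")
    case True
    have "(\<Prod>r\<in>UNIV. integral\<^sup>L (M r) (F r)) = (\<Prod>r\<in>UNIV. if r = i then \<integral>x. (X i x)\<^sup>2 \<partial>M i else 1)"
      using True by (intro prod.cong) (auto simp: F_cases prob_space)
    with True show ?thesis by simp
  next
    case False
    then have "integral\<^sup>L (M i) (F i) = 0" by (simp add: F_cases zero)
    with False show ?thesis by (auto intro!: prod_zero)
  qed
  finally show "(\<integral>y. X i (y i) * X k (y k) \<partial>Pi\<^sub>M UNIV M) = (if i = k then \<integral>x. (X i x)\<^sup>2 \<partial>M i else 0)" .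
qed

text \<open>
  Pythagoras in \<open>L\<^sup>2\<close>: after expanding the square the mixed terms vanish. Here the information matrix
  loses its interactions between different runs.
\<close>

lemma PiM_integral_square_sum:
  fixes X :: "'i::finite \<Rightarrow> 'a \<Rightarrow> real" and M :: "'i \<Rightarrow> 'a measure" and c :: "'i \<Rightarrow> real"
  assumes prob: "\<And>i. prob_space (M i)"
    and int: "\<And>i. integrable (M i) (X i)"
    and sq: "\<And>i. integrable (M i) (\<lambda>x. (X i x)\<^sup>2)"
    and zero: "\<And>i. (\<integral>x. X i x \<partial>M i) = 0"
  shows "(\<integral>y. (\<Sum>i\<in>UNIV. X i (y i) * c i)\<^sup>2 \<partial>Pi\<^sub>M UNIV M) = (\<Sum>i\<in>UNIV. (c i)\<^sup>2 * (\<integral>x. (X i x)\<^sup>2 \<partial>M i))"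
proof -
  note pair = PiM_integral_pair[where M = M and X = X, OF prob int sq zero]
  have "(\<integral>y. (\<Sum>i\<in>UNIV. X i (y i) * c i)\<^sup>2 \<partial>Pi\<^sub>M UNIV M)
      = (\<integral>y. (\<Sum>i\<in>UNIV. \<Sum>k\<in>UNIV. c i * c k * (X i (y i) * X k (y k))) \<partial>Pi\<^sub>M UNIV M)"
    by (simp add: power2_eq_square sum_product mult_ac)
  also have "\<dots> = (\<Sum>i\<in>UNIV. \<Sum>k\<in>UNIV. c i * c k * (\<integral>y. X i (y i) * X k (y k) \<partial>Pi\<^sub>M UNIV M))"
    by (simp add: pair(1))
  also have "\<dots> = (\<Sum>i\<in>UNIV. (c i)\<^sup>2 * (\<integral>x. (X i x)\<^sup>2 \<partial>M i))"
    by (simp add: pair(2) if_distrib[where f = "\<lambda>x. _ * x"] power2_eq_square sum.delta cong: if_cong)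
  finally show ?thesis .
qed

section \<open>Derivatives along lines\<close>

text \<open>
  The derivative is a pointwise limit of difference quotients of step \<open>1 / (n + 1)\<close>, which are Borel
  functions. Extending \<open>g\<close> by zero outside \<open>S\<close> makes the quotients meaningful even where the step
  leaves \<open>S\<close>; as \<open>S\<close> is open, this happens for finitely many \<open>n\<close> at each point of \<open>S\<close>. Besides partial
  derivatives this covers the derivative of a function of a real variable, with \<open>v = 1\<close>.
\<close>

lemma borel_measurable_directional_deriv:
  fixes g :: "'a::euclidean_space \<Rightarrow> real"
  assumes S: "open S" and cont: "continuous_on S g"
    and diff: "\<And>x. x \<in> S \<Longrightarrow> (\<lambda>t. g (x + t *\<^sub>R v)) differentiable (at (0::real))"
  shows "(\<lambda>x. deriv (\<lambda>t. g (x + t *\<^sub>R v)) 0) \<in> borel_measurable (restrict_space borel S)"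
proof (rule borel_measurable_LIMSEQ_real)
  define h where "h x = indicator S x *\<^sub>R g x" for x
  define s where "s n = inverse (real (Suc n))" for n
  have [measurable]: "h \<in> borel_measurable borel"
    unfolding h_def using S cont by (intro borel_measurable_continuous_on_indicator) auto
  show "(\<lambda>x. (h (x + s n *\<^sub>R v) - h x) / s n) \<in> borel_measurable (restrict_space borel S)" for n
    by (intro measurable_restrict_space1) measurable
  fix x assume "x \<in> space (restrict_space borel S)"
  then have x: "x \<in> S" by (simp add: space_restrict_space)
  have s: "s \<longlonglongrightarrow> 0" unfolding s_def by (rule LIMSEQ_inverse_real_of_nat)
  then have s0: "filterlim s (at 0) sequentially"
    by (auto simp: filterlim_at s_def)
  have "((\<lambda>t. g (x + t *\<^sub>R v)) has_real_derivative deriv (\<lambda>t. g (x + t *\<^sub>R v)) 0) (at 0)"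
    using diff[OF x] by (simp add: DERIV_deriv_iff_real_differentiable)
  then have "((\<lambda>t. (g (x + t *\<^sub>R v) - g x) / t) \<longlongrightarrow> deriv (\<lambda>t. g (x + t *\<^sub>R v)) 0) (at 0)"
    by (simp add: DERIV_def)
  from filterlim_compose[OF this s0]
  have lim: "(\<lambda>n. (g (x + s n *\<^sub>R v) - g x) / s n) \<longlonglongrightarrow> deriv (\<lambda>t. g (x + t *\<^sub>R v)) 0" .
  have "(\<lambda>n. x + s n *\<^sub>R v) \<longlonglongrightarrow> x + 0 *\<^sub>R v"
    by (intro tendsto_intros s)
  then have "\<forall>\<^sub>F n in sequentially. x + s n *\<^sub>R v \<in> S"
    using S x by (auto dest: topological_tendstoD)
  then have "\<forall>\<^sub>F n in sequentially. (g (x + s n *\<^sub>R v) - g x) / s n = (h (x + s n *\<^sub>R v) - h x) / s n"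
    by eventually_elim (use x in \<open>simp add: h_def\<close>)
  from Lim_transform_eventually[OF lim this]
  show "(\<lambda>n. (h (x + s n *\<^sub>R v) - h x) / s n) \<longlonglongrightarrow> deriv (\<lambda>t. g (x + t *\<^sub>R v)) 0" .
qed

lemma has_real_derivative_partial_deriv:
  fixes g :: "real ^ 'p \<Rightarrow> real"
  assumes "g differentiable (at \<theta>)"
  shows "((\<lambda>t. g (\<theta> + t *\<^sub>R axis j 1)) has_real_derivative partial_deriv j g \<theta>) (at 0)"
proof -
  have "(\<lambda>t::real. \<theta> + t *\<^sub>R axis j 1) differentiable (at 0)"
    by simp
  moreover have "g differentiable (at (\<theta> + 0 *\<^sub>R axis j 1))" using assms by simp
  ultimately have "(g \<circ> (\<lambda>t::real. \<theta> + t *\<^sub>R axis j 1)) differentiable (at 0)"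
    by (intro differentiable_chain_at) simp_all
  then show ?thesis
    unfolding partial_deriv_def o_def by (simp add: DERIV_deriv_iff_real_differentiable)
qed

text \<open>
  A positive derivative makes \<open>G\<close> strictly increasing on the interval \<open>Z\<close>, hence invertible. As
  \<open>G'\<close> may be discontinuous, the inverse is differentiated by the form of the inverse function theorem
  that starts from injectivity on an open set and the derivative at a single point.
\<close>

lemma has_real_derivative_inverse_of_deriv_pos:
  fixes G G' :: "real \<Rightarrow> real"
  assumes Z: "open Z" "is_interval Z"
    and G: "\<And>z. z \<in> Z \<Longrightarrow> (G has_real_derivative G' z) (at z)"
    and pos: "\<And>z. z \<in> Z \<Longrightarrow> G' z > 0"
  obtains k where "\<And>z. z \<in> Z \<Longrightarrow> k (G z) = z"
    and "\<And>z. z \<in> Z \<Longrightarrow> (k has_real_derivative inverse (G' z)) (at (G z))"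
proof -
  have mono: "G x < G y" if "x \<in> Z" "y \<in> Z" "x < y" for x y
  proof (rule DERIV_pos_imp_increasing[OF that(3)])
    fix w assume "x \<le> w" "w \<le> y"
    then have "w \<in> Z" using Z(2) that unfolding is_interval_1 by blast
    then show "\<exists>y. (G has_real_derivative y) (at w) \<and> 0 < y" using G pos by blast
  qed
  then have inj: "inj_on G Z"
    by (intro inj_onI) (metis linorder_neqE less_irrefl)
  define k where "k = the_inv_into Z G"
  have k: "k (G z) = z" if "z \<in> Z" for z
    using the_inv_into_f_f[OF inj that] by (simp add: k_def)
  have cont: "continuous_on Z G"
    using G by (meson DERIV_continuous continuous_at_imp_continuous_on)
  have "(k has_real_derivative inverse (G' z)) (at (G z))" if "z \<in> Z" for z
    unfolding has_field_derivative_def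
    by (rule has_derivative_inverse_strong[OF Z(1) that cont k G[OF that, unfolded has_field_derivative_def]])
      (use pos[OF that] in \<open>auto simp: fun_eq_iff\<close>)
  with k show thesis by (rule that)
qed

section \<open>The Fisher information of the exponential family model\<close>

locale expfam_model =
  fixes \<D> :: "(real ^ 'k) set"
    and \<Theta> :: "(real ^ 'p) set"
    and \<nu> :: "real measure"
    and a b c1 c2 :: "real \<Rightarrow> real"
    and \<gamma> :: real
    and Z :: "real set"
    and \<zeta> \<mu> :: "real ^ 'p \<Rightarrow> real ^ 'k \<Rightarrow> real"
    and f :: "real ^ 'p \<Rightarrow> real ^ 'k \<Rightarrow> real \<Rightarrow> real"
  assumes Theta_open: "open \<Theta>"
    and gamma_pos: "\<gamma> > 0"
    and base: "response_base \<nu>"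
    and Z_interval: "open Z" "is_interval Z"
    and b_smooth: "b differentiable_on Z" "deriv b differentiable_on Z"
    and family_prob: "\<And>z. z \<in> Z \<Longrightarrow> prob_space (law \<nu> (expfam_density a b c1 c2 \<gamma> z))"
    and family_mean: "\<And>z. z \<in> Z \<Longrightarrow> prob_space.expectation (law \<nu> (expfam_density a b c1 c2 \<gamma> z)) (\<lambda>y. y) = deriv b z"
    and family_var: "\<And>z. z \<in> Z \<Longrightarrow>
          prob_space.variance (law \<nu> (expfam_density a b c1 c2 \<gamma> z)) (\<lambda>y. y) = \<gamma> * deriv (deriv b) z"
    and family_var_pos: "\<And>z. z \<in> Z \<Longrightarrow> \<gamma> * deriv (deriv b) z > 0"
    and mu_diff: "\<And>\<theta> d. \<theta> \<in> \<Theta> \<Longrightarrow> d \<in> \<D> \<Longrightarrow> (\<lambda>t. \<mu> t d) differentiable (at \<theta>)"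
    and zeta_in: "\<And>\<theta> d. \<theta> \<in> \<Theta> \<Longrightarrow> d \<in> \<D> \<Longrightarrow> \<zeta> \<theta> d \<in> Z"
    and zeta_mu: "\<And>\<theta> d. \<theta> \<in> \<Theta> \<Longrightarrow> d \<in> \<D> \<Longrightarrow> deriv b (\<zeta> \<theta> d) = \<mu> \<theta> d"
    and model: "\<And>\<theta> d y. \<theta> \<in> \<Theta> \<Longrightarrow> d \<in> \<D> \<Longrightarrow> y \<in> space \<nu> \<Longrightarrow>
          f \<theta> d y = expfam_density a b c1 c2 \<gamma> (\<zeta> \<theta> d) y"
begin

definition resp_var :: "real ^ 'p \<Rightarrow> real ^ 'k \<Rightarrow> real" where
  "resp_var \<theta> d = prob_space.variance (law \<nu> (f \<theta> d)) (\<lambda>y. y)"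

text \<open>
  The contribution of a run at \<open>d\<close> to the diagonal entry \<open>j\<close> of the information matrix
  \<open>M\<^sup>T W M\<close>. Up to exchanging the sum over \<open>j\<close> with the prior expectation, \<open>\<phi> d\<close> is the
  expectation of the sum of these contributions.
\<close>

definition info_term :: "'p \<Rightarrow> real ^ 'p \<Rightarrow> real ^ 'k \<Rightarrow> real" where
  "info_term j \<theta> d = 1 / resp_var \<theta> d * (partial_deriv j (\<lambda>t. \<mu> t d) \<theta>)\<^sup>2"

lemma deriv_b: "z \<in> Z \<Longrightarrow> (b has_real_derivative deriv b z) (at z)"
  using b_smooth(1) Z_interval(1)
  by (simp add: differentiable_on_eq_differentiable_at DERIV_deriv_iff_real_differentiable)

lemma deriv_deriv_b: "z \<in> Z \<Longrightarrow> (deriv b has_real_derivative deriv (deriv b) z) (at z)"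
  using b_smooth(2) Z_interval(1)
  by (simp add: differentiable_on_eq_differentiable_at DERIV_deriv_iff_real_differentiable)

lemma deriv2_b_pos: "z \<in> Z \<Longrightarrow> deriv (deriv b) z > 0"
  using family_var_pos gamma_pos by (simp add: zero_less_mult_iff)

lemma law_model: "\<theta> \<in> \<Theta> \<Longrightarrow> d \<in> \<D> \<Longrightarrow> law \<nu> (f \<theta> d) = law \<nu> (expfam_density a b c1 c2 \<gamma> (\<zeta> \<theta> d))"
  by (rule law_cong) (rule model)

lemma resp_var_eq: "\<theta> \<in> \<Theta> \<Longrightarrow> d \<in> \<D> \<Longrightarrow> resp_var \<theta> d = \<gamma> * deriv (deriv b) (\<zeta> \<theta> d)"
  by (simp add: resp_var_def law_model family_var zeta_in)

lemma resp_var_pos: "\<theta> \<in> \<Theta> \<Longrightarrow> d \<in> \<D> \<Longrightarrow> resp_var \<theta> d > 0"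
  by (simp add: resp_var_eq family_var_pos zeta_in)

text \<open>
  Integrability follows from the moment formulas of the family: the integral defining the variance
  would be zero if its integrand were not integrable, but the variance is positive. A square
  integrable function is integrable under a probability measure.
\<close>

lemma centred_response:
  assumes "\<theta> \<in> \<Theta>" "d \<in> \<D>"
  shows "prob_space (law \<nu> (f \<theta> d))"
    and "integrable (law \<nu> (f \<theta> d)) (\<lambda>y. y - \<mu> \<theta> d)"
    and "integrable (law \<nu> (f \<theta> d)) (\<lambda>y. (y - \<mu> \<theta> d)\<^sup>2)"
    and "(\<integral>y. y - \<mu> \<theta> d \<partial>law \<nu> (f \<theta> d)) = 0"
    and "(\<integral>y. (y - \<mu> \<theta> d)\<^sup>2 \<partial>law \<nu> (f \<theta> d)) = resp_var \<theta> d"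
proof -
  let ?L = "law \<nu> (f \<theta> d)"
  show prob: "prob_space ?L" using assms by (simp add: law_model family_prob zeta_in)
  interpret prob_space ?L by (rule prob)
  have mean: "expectation (\<lambda>y. y) = \<mu> \<theta> d"
    using assms by (simp add: law_model family_mean zeta_in zeta_mu)
  show var: "(\<integral>y. (y - \<mu> \<theta> d)\<^sup>2 \<partial>?L) = resp_var \<theta> d"
    by (simp add: resp_var_def mean)
  show sq: "integrable ?L (\<lambda>y. (y - \<mu> \<theta> d)\<^sup>2)"
    using resp_var_pos[OF assms] var by (metis not_integrable_integral_eq less_irrefl)
  have [measurable]: "(\<lambda>y. y) \<in> borel_measurable \<nu>"
    by (rule response_base_measurable_id[OF base])
  show int: "integrable ?L (\<lambda>y. y - \<mu> \<theta> d)"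
    by (rule square_integrable_imp_integrable[OF _ sq]) measurable
  have "integrable ?L (\<lambda>y. (y - \<mu> \<theta> d) + \<mu> \<theta> d)"
    by (intro Bochner_Integration.integrable_add int) simp
  then have "integrable ?L (\<lambda>y. y)" by simp
  then show "(\<integral>y. y - \<mu> \<theta> d \<partial>?L) = 0"
    using prob_space by (simp add: mean)
qed

text \<open>
  The natural parameter inherits its regularity from the mean function: since \<open>b' (\<zeta> \<theta> d) = \<mu> \<theta> d\<close>
  and \<open>b'' > 0\<close>, it is a differentiable function of \<open>\<mu> \<theta> d\<close>, the same for all \<open>\<theta>\<close> and \<open>d\<close>.
\<close>

lemma zeta_through_mu:
  obtains k where "\<And>\<theta> d. \<theta> \<in> \<Theta> \<Longrightarrow> d \<in> \<D> \<Longrightarrow> \<zeta> \<theta> d = k (\<mu> \<theta> d)"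
    and "\<And>\<theta> d. \<theta> \<in> \<Theta> \<Longrightarrow> d \<in> \<D> \<Longrightarrow>
      (k has_real_derivative inverse (deriv (deriv b) (\<zeta> \<theta> d))) (at (\<mu> \<theta> d))"
proof -
  obtain k where k: "\<And>z. z \<in> Z \<Longrightarrow> k (deriv b z) = z"
    and dk: "\<And>z. z \<in> Z \<Longrightarrow> (k has_real_derivative inverse (deriv (deriv b) z)) (at (deriv b z))"
    using has_real_derivative_inverse_of_deriv_pos[OF Z_interval deriv_deriv_b deriv2_b_pos] by blast
  show thesis
  proof (rule that)
    fix \<theta> d assume "\<theta> \<in> \<Theta>" "d \<in> \<D>"
    then show "\<zeta> \<theta> d = k (\<mu> \<theta> d)"
      and "(k has_real_derivative inverse (deriv (deriv b) (\<zeta> \<theta> d))) (at (\<mu> \<theta> d))"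
      using k[OF zeta_in] dk[OF zeta_in] by (simp_all add: zeta_mu)
  qed
qed

lemma continuous_on_mu: "d \<in> \<D> \<Longrightarrow> continuous_on \<Theta> (\<lambda>\<theta>. \<mu> \<theta> d)"
  by (intro differentiable_imp_continuous_on differentiable_at_imp_differentiable_on mu_diff)

lemma continuous_on_zeta:
  assumes "d \<in> \<D>"
  shows "continuous_on \<Theta> (\<lambda>\<theta>. \<zeta> \<theta> d)"
proof -
  obtain k where k: "\<And>\<theta> d. \<theta> \<in> \<Theta> \<Longrightarrow> d \<in> \<D> \<Longrightarrow> \<zeta> \<theta> d = k (\<mu> \<theta> d)"
    and dk: "\<And>\<theta> d. \<theta> \<in> \<Theta> \<Longrightarrow> d \<in> \<D> \<Longrightarrow>
      (k has_real_derivative inverse (deriv (deriv b) (\<zeta> \<theta> d))) (at (\<mu> \<theta> d))"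
    by (rule zeta_through_mu) blast
  have "continuous_on ((\<lambda>\<theta>. \<mu> \<theta> d) ` \<Theta>) k"
    using dk assms by (intro continuous_at_imp_continuous_on) (auto intro: DERIV_isCont)
  from continuous_on_compose[OF continuous_on_mu[OF assms] this]
  show ?thesis using assms by (simp add: o_def k cong: continuous_on_cong)
qed

lemma eventually_line_in_Theta:
  assumes "\<theta> \<in> \<Theta>"
  shows "\<forall>\<^sub>F t in nhds (0::real). \<theta> + t *\<^sub>R v \<in> \<Theta>"
proof -
  have "((\<lambda>t::real. \<theta> + t *\<^sub>R v) \<longlongrightarrow> \<theta> + 0 *\<^sub>R v) (nhds 0)"
    by (intro tendsto_intros filterlim_ident)
  then show ?thesis using Theta_open assms by (auto dest: topological_tendstoD)
qed

lemma has_real_derivative_zeta: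
  assumes "\<theta> \<in> \<Theta>" "d \<in> \<D>"
  shows "((\<lambda>t. \<zeta> (\<theta> + t *\<^sub>R axis j 1) d) has_real_derivative
           partial_deriv j (\<lambda>t. \<mu> t d) \<theta> / deriv (deriv b) (\<zeta> \<theta> d)) (at 0)"
proof -
  obtain k where k: "\<And>\<theta> d. \<theta> \<in> \<Theta> \<Longrightarrow> d \<in> \<D> \<Longrightarrow> \<zeta> \<theta> d = k (\<mu> \<theta> d)"
    and dk: "\<And>\<theta> d. \<theta> \<in> \<Theta> \<Longrightarrow> d \<in> \<D> \<Longrightarrow>
      (k has_real_derivative inverse (deriv (deriv b) (\<zeta> \<theta> d))) (at (\<mu> \<theta> d))"
    by (rule zeta_through_mu) blast
  have "((\<lambda>t. k (\<mu> (\<theta> + t *\<^sub>R axis j 1) d)) has_real_derivative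
      inverse (deriv (deriv b) (\<zeta> \<theta> d)) * partial_deriv j (\<lambda>t. \<mu> t d) \<theta>) (at 0)"
    using dk[OF assms] has_real_derivative_partial_deriv[OF mu_diff[OF assms], of j]
    by (intro DERIV_chain2[where g = "\<lambda>t. \<mu> (\<theta> + t *\<^sub>R axis j 1) d"]) simp_all
  moreover have "\<forall>\<^sub>F t in nhds 0. \<zeta> (\<theta> + t *\<^sub>R axis j 1) d = k (\<mu> (\<theta> + t *\<^sub>R axis j 1) d)"
    using eventually_line_in_Theta[OF assms(1), of "axis j 1"] by eventually_elim (use assms in \<open>simp add: k\<close>)
  ultimately show ?thesis
    by (subst DERIV_cong_ev[OF refl _ refl]) (simp_all add: field_simps)
qed

text \<open>
  On the support of the responses the log-likelihood is a sum over the runs of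
  \<open>(y\<^sub>i \<zeta>\<^sub>i - b \<zeta>\<^sub>i) / \<gamma>\<close> and terms free of the parameters. As \<open>b' \<zeta>\<^sub>i = \<mu>\<^sub>i\<close>, the derivative of a
  summand with respect to \<open>\<zeta>\<^sub>i\<close> is \<open>(y\<^sub>i - \<mu>\<^sub>i) / \<gamma>\<close>; the chain rule multiplies it by the derivative
  of \<open>\<zeta>\<^sub>i\<close>, which is that of \<open>\<mu>\<^sub>i\<close> divided by \<open>b'' \<zeta>\<^sub>i\<close>, and \<open>\<gamma> b'' \<zeta>\<^sub>i\<close> is the variance.
\<close>

lemma score_eq:
  fixes E :: "real ^ 'k ^ 'n"
  assumes \<theta>: "\<theta> \<in> \<Theta>" and E: "E \<in> designs \<D>" and y: "\<And>i. y i \<in> space \<nu>"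
  shows "score f \<theta> E y $ j =
    (\<Sum>i\<in>UNIV. (y i - \<mu> \<theta> (E $ i)) * (partial_deriv j (\<lambda>t. \<mu> t (E $ i)) \<theta> / resp_var \<theta> (E $ i)))"
proof -
  let ?l = "\<lambda>t. \<theta> + t *\<^sub>R axis j (1::real)"
  let ?log = "\<lambda>i t. (y i * \<zeta> (?l t) (E $ i) - b (\<zeta> (?l t) (E $ i)) - c1 (y i)) / \<gamma>
     - 1 / 2 * a (- 1 / \<gamma>) + c2 (y i)"
  have Ei: "E $ i \<in> \<D>" for i using E by (simp add: designs_def)
  have "(?log i has_real_derivative
      (y i - \<mu> \<theta> (E $ i)) * (partial_deriv j (\<lambda>t. \<mu> t (E $ i)) \<theta> / resp_var \<theta> (E $ i))) (at 0)" for i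
  proof -
    note dz = has_real_derivative_zeta[OF \<theta> Ei, of j i]
    have "((\<lambda>t. b (\<zeta> (?l t) (E $ i))) has_real_derivative
        \<mu> \<theta> (E $ i) * (partial_deriv j (\<lambda>t. \<mu> t (E $ i)) \<theta> / deriv (deriv b) (\<zeta> \<theta> (E $ i)))) (at 0)"
      using deriv_b[OF zeta_in[OF \<theta> Ei[of i]]] \<theta> Ei[of i]
      by (intro DERIV_chain2[OF _ dz]) (simp add: zeta_mu)
    note [derivative_intros] = dz this
    show ?thesis
      using gamma_pos deriv2_b_pos[OF zeta_in[OF \<theta> Ei[of i]]]
      by (auto intro!: derivative_eq_intros simp: resp_var_eq[OF \<theta> Ei] field_simps)
  qed
  then have "((\<lambda>t. \<Sum>i\<in>UNIV. ?log i t) has_real_derivative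
      (\<Sum>i\<in>UNIV. (y i - \<mu> \<theta> (E $ i)) * (partial_deriv j (\<lambda>t. \<mu> t (E $ i)) \<theta> / resp_var \<theta> (E $ i)))) (at 0)"
    by (intro DERIV_sum) simp
  moreover have "\<forall>\<^sub>F t in nhds 0. ln (joint_density f (?l t) E y) = (\<Sum>i\<in>UNIV. ?log i t)"
    using eventually_line_in_Theta[OF \<theta>, of "axis j 1"]
  proof eventually_elim
    case (elim t)
    then show ?case
      by (simp add: joint_density_def model Ei y expfam_density_def ln_prod)
  qed
  ultimately have "((\<lambda>t. ln (joint_density f (?l t) E y)) has_real_derivative
      (\<Sum>i\<in>UNIV. (y i - \<mu> \<theta> (E $ i)) * (partial_deriv j (\<lambda>t. \<mu> t (E $ i)) \<theta> / resp_var \<theta> (E $ i)))) (at 0)"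
    by (subst DERIV_cong_ev[OF refl _ refl]) simp_all
  then show ?thesis
    by (simp add: score_def partial_deriv_def DERIV_imp_deriv)
qed

text \<open>
  The score is a linear combination of independent centred responses, so each diagonal entry of the
  information matrix is the sum over the runs of a squared coefficient times a variance. The
  coefficient is the partial derivative of the mean divided by the variance, and one power of the
  variance cancels.
\<close>

lemma trace_fisher_info:
  fixes E :: "real ^ 'k ^ 'n"
  assumes \<theta>: "\<theta> \<in> \<Theta>" and E: "E \<in> designs \<D>"
  shows "trace (fisher_info \<nu> f \<theta> E) = (\<Sum>i\<in>UNIV. \<Sum>j\<in>UNIV. info_term j \<theta> (E $ i))"
proof -
  have Ei: "E $ i \<in> \<D>" for i using E by (simp add: designs_def)
  have "fisher_info \<nu> f \<theta> E $ j $ j = (\<Sum>i\<in>UNIV. info_term j \<theta> (E $ i))" for j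
  proof -
    let ?c = "\<lambda>i. partial_deriv j (\<lambda>t. \<mu> t (E $ i)) \<theta> / resp_var \<theta> (E $ i)"
    have "fisher_info \<nu> f \<theta> E $ j $ j
        = (\<integral>y. (\<Sum>i\<in>UNIV. (y i - \<mu> \<theta> (E $ i)) * ?c i)\<^sup>2 \<partial>Pi\<^sub>M UNIV (\<lambda>i. law \<nu> (f \<theta> (E $ i))))"
      unfolding fisher_info_def joint_law_def
      by (auto intro!: Bochner_Integration.integral_cong
          simp: score_eq[OF \<theta> E] space_PiM PiE_iff power2_eq_square)
    also have "\<dots> = (\<Sum>i\<in>UNIV. (?c i)\<^sup>2 * (\<integral>x. (x - \<mu> \<theta> (E $ i))\<^sup>2 \<partial>law \<nu> (f \<theta> (E $ i))))"
      by (rule PiM_integral_square_sum) (intro centred_response \<theta> Ei)+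
    also have "\<dots> = (\<Sum>i\<in>UNIV. info_term j \<theta> (E $ i))"
      using resp_var_pos[OF \<theta> Ei]
      by (intro sum.cong) (simp_all add: centred_response(5)[OF \<theta> Ei] info_term_def power_divide,
        simp add: power2_eq_square)
    finally show ?thesis .
  qed
  then show ?thesis
    unfolding trace_def by (simp add: sum.swap[of _ "UNIV :: 'p set"])
qed

section \<open>Exchanging the prior expectation with the sums\<close>

lemma info_term_nonneg: "\<theta> \<in> \<Theta> \<Longrightarrow> d \<in> \<D> \<Longrightarrow> info_term j \<theta> d \<ge> 0"
  using resp_var_pos by (simp add: info_term_def less_imp_le)

text \<open>
  The variance is \<open>\<gamma> b''\<close> evaluated at the continuous function \<open>\<zeta>\<close>, and \<open>b''\<close> is Borel because it
  is a derivative, although it may be discontinuous; the same applies to the partial derivatives of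
  \<open>\<mu>\<close>.
\<close>

lemma borel_measurable_info_term:
  assumes d: "d \<in> \<D>"
  shows "(\<lambda>\<theta>. info_term j \<theta> d) \<in> borel_measurable (restrict_space borel \<Theta>)"
proof -
  have shift: "((\<lambda>t. deriv b (z + t *\<^sub>R 1)) has_real_derivative deriv (deriv b) z) (at 0)" if "z \<in> Z" for z
    using deriv_deriv_b[OF that] DERIV_shift[of "deriv b" _ 0 z] by (simp add: add.commute)
  have "(\<lambda>z. deriv (\<lambda>t. deriv b (z + t *\<^sub>R 1)) 0) \<in> borel_measurable (restrict_space borel Z)"
    using b_smooth(2) shift
    by (intro borel_measurable_directional_deriv Z_interval(1) differentiable_imp_continuous_on)
      (auto simp: real_differentiable_def)
  then have [measurable]: "deriv (deriv b) \<in> borel_measurable (restrict_space borel Z)"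
    by (rule measurable_cong[THEN iffD1, rotated])
      (use shift in \<open>auto simp: space_restrict_space intro: DERIV_imp_deriv\<close>)
  have [measurable]: "(\<lambda>\<theta>. \<zeta> \<theta> d) \<in> measurable (restrict_space borel \<Theta>) (restrict_space borel Z)"
    using zeta_in d
    by (intro measurable_restrict_space2 borel_measurable_continuous_on_restrict continuous_on_zeta)
      (auto simp: space_restrict_space)
  have [measurable]: "partial_deriv j (\<lambda>t. \<mu> t d) \<in> borel_measurable (restrict_space borel \<Theta>)"
    unfolding partial_deriv_def[abs_def]
    using has_real_derivative_partial_deriv[OF mu_diff[OF _ d]]
    by (intro borel_measurable_directional_deriv Theta_open continuous_on_mu d)
      (auto simp: real_differentiable_def)
  have "(\<lambda>\<theta>. 1 / (\<gamma> * deriv (deriv b) (\<zeta> \<theta> d)) * (partial_deriv j (\<lambda>t. \<mu> t d) \<theta>)\<^sup>2)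
      \<in> borel_measurable (restrict_space borel \<Theta>)"
    by measurable
  then show ?thesis
    by (rule measurable_cong[THEN iffD1, rotated])
      (simp add: space_restrict_space info_term_def resp_var_eq d)
qed

text \<open>
  Finiteness is known for the trace of the information of a design only. The design that repeats \<open>d\<close>
  in every run has a trace that is a sum of nonnegative terms, one of which is the given one.
\<close>

lemma integrable_info_term:
  assumes prior_sets: "sets prior = sets (restrict_space borel \<Theta>)"
    and U_finite: "\<And>E :: real ^ 'k ^ 'n. E \<in> designs \<D> \<Longrightarrow> integrable prior (\<lambda>\<theta>. trace (fisher_info \<nu> f \<theta> E))"
    and d: "d \<in> \<D>"
  shows "integrable prior (\<lambda>\<theta>. info_term j \<theta> d)"
proof (rule Bochner_Integration.integrable_bound)
  let ?E = "(\<chi> i. d) :: real ^ 'k ^ 'n"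
  have E: "?E \<in> designs \<D>" using d by (simp add: designs_def)
  show "integrable prior (\<lambda>\<theta>. trace (fisher_info \<nu> f \<theta> ?E))" by (rule U_finite[OF E])
  show "(\<lambda>\<theta>. info_term j \<theta> d) \<in> borel_measurable prior"
    using borel_measurable_info_term[OF d] by (simp cong: measurable_cong_sets add: prior_sets)
  have space: "space prior = \<Theta>"
    using sets_eq_imp_space_eq[OF prior_sets] by (simp add: space_restrict_space)
  have "norm (info_term j \<theta> d) \<le> norm (trace (fisher_info \<nu> f \<theta> ?E))" if "\<theta> \<in> \<Theta>" for \<theta>
  proof -
    have nn: "0 \<le> info_term l \<theta> d" for l using info_term_nonneg[OF that d] .
    have "info_term j \<theta> d \<le> (\<Sum>l\<in>UNIV. info_term l \<theta> d)"
      by (rule member_le_sum) (auto simp: nn)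
    also have "\<dots> \<le> (\<Sum>i\<in>(UNIV::'n set). \<Sum>l\<in>UNIV. info_term l \<theta> d)"
      by (rule member_le_sum[where f = "\<lambda>_. \<Sum>l\<in>UNIV. info_term l \<theta> d" and i = undefined]) (auto simp: nn intro: sum_nonneg)
    also have "\<dots> = trace (fisher_info \<nu> f \<theta> ?E)"
      by (simp add: trace_fisher_info[OF that E])
    finally show ?thesis using nn[of j] by simp
  qed
  then show "AE \<theta> in prior. norm (info_term j \<theta> d) \<le> norm (trace (fisher_info \<nu> f \<theta> ?E))"
    by (intro AE_I2) (simp add: space)
qed

lemma U_FIG_eq_sum_FIG_phi:
  fixes E :: "real ^ 'k ^ 'n"
  assumes prior_sets: "sets prior = sets (restrict_space borel \<Theta>)"
    and U_finite: "\<And>E :: real ^ 'k ^ 'n. E \<in> designs \<D> \<Longrightarrow> integrable prior (\<lambda>\<theta>. trace (fisher_info \<nu> f \<theta> E))"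
    and E: "E \<in> designs \<D>"
  shows "U_FIG prior \<nu> f E = (\<Sum>i\<in>UNIV. FIG_phi prior \<nu> f \<mu> (E $ i))"
proof -
  have Ei: "E $ i \<in> \<D>" for i using E by (simp add: designs_def)
  have space: "space prior = \<Theta>"
    using sets_eq_imp_space_eq[OF prior_sets] by (simp add: space_restrict_space)
  have "U_FIG prior \<nu> f E = (\<integral>\<theta>. (\<Sum>i\<in>UNIV. \<Sum>j\<in>UNIV. info_term j \<theta> (E $ i)) \<partial>prior)"
    unfolding U_FIG_def
    by (intro Bochner_Integration.integral_cong) (simp_all add: space trace_fisher_info[OF _ E])
  also have "\<dots> = (\<Sum>i\<in>UNIV. \<Sum>j\<in>UNIV. \<integral>\<theta>. info_term j \<theta> (E $ i) \<partial>prior)"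
    by (simp add: integrable_info_term[OF prior_sets U_finite Ei])
  finally show ?thesis
    by (simp add: FIG_phi_def info_term_def resp_var_def)
qed

end

section \<open>Optimal designs\<close>

theorem lemma3p1:
  fixes \<D> :: "(real ^ 'k) set"
    and \<Theta> :: "(real ^ 'p) set"
    and prior :: "(real ^ 'p) measure"
    and \<nu> :: "real measure"
    and a b c1 c2 :: "real \<Rightarrow> real"
    and \<gamma> :: real
    and Z :: "real set"
    and \<zeta> \<mu> :: "real ^ 'p \<Rightarrow> real ^ 'k \<Rightarrow> real"
    and f :: "real ^ 'p \<Rightarrow> real ^ 'k \<Rightarrow> real \<Rightarrow> real"
    and D :: "real ^ 'k ^ 'n"
  assumes p_le_n: "CARD('p) \<le> CARD('n)"
    and Theta_open: "open \<Theta>"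
    and prior_prob: "prob_space prior"
    and prior_sets: "sets prior = sets (restrict_space borel \<Theta>)"
    and gamma_pos: "\<gamma> > 0"
    and base: "response_base \<nu>"
    and c_meas: "c1 \<in> borel_measurable \<nu>" "c2 \<in> borel_measurable \<nu>"
    and Z_interval: "open Z" "is_interval Z"
    and b_smooth: "b differentiable_on Z" "deriv b differentiable_on Z"
    and family_prob: "\<And>z. z \<in> Z \<Longrightarrow> prob_space (law \<nu> (expfam_density a b c1 c2 \<gamma> z))"
    and family_mean: "\<And>z. z \<in> Z \<Longrightarrow> prob_space.expectation (law \<nu> (expfam_density a b c1 c2 \<gamma> z)) (\<lambda>y. y) = deriv b z"
    and family_var: "\<And>z. z \<in> Z \<Longrightarrow>
          prob_space.variance (law \<nu> (expfam_density a b c1 c2 \<gamma> z)) (\<lambda>y. y) = \<gamma> * deriv (deriv b) z"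
    and family_var_pos: "\<And>z. z \<in> Z \<Longrightarrow> \<gamma> * deriv (deriv b) z > 0"
    and mu_diff: "\<And>\<theta> d. \<theta> \<in> \<Theta> \<Longrightarrow> d \<in> \<D> \<Longrightarrow> (\<lambda>t. \<mu> t d) differentiable (at \<theta>)"
    and zeta_in: "\<And>\<theta> d. \<theta> \<in> \<Theta> \<Longrightarrow> d \<in> \<D> \<Longrightarrow> \<zeta> \<theta> d \<in> Z"
    and zeta_mu: "\<And>\<theta> d. \<theta> \<in> \<Theta> \<Longrightarrow> d \<in> \<D> \<Longrightarrow> deriv b (\<zeta> \<theta> d) = \<mu> \<theta> d"
    and model: "\<And>\<theta> d y. \<theta> \<in> \<Theta> \<Longrightarrow> d \<in> \<D> \<Longrightarrow> y \<in> space \<nu> \<Longrightarrow>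
          f \<theta> d y = expfam_density a b c1 c2 \<gamma> (\<zeta> \<theta> d) y"
    and fisher_finite: "\<And>\<theta> (E :: real ^ 'k ^ 'n) j l. \<theta> \<in> \<Theta> \<Longrightarrow> E \<in> designs \<D> \<Longrightarrow>
          integrable (joint_law \<nu> f \<theta> E) (\<lambda>y. score f \<theta> E y $ j * score f \<theta> E y $ l)"
    and U_finite: "\<And>E :: real ^ 'k ^ 'n. E \<in> designs \<D> \<Longrightarrow>
          integrable prior (\<lambda>\<theta>. trace (fisher_info \<nu> f \<theta> E))"
    and D_design: "D \<in> designs \<D>"
  shows "FIG_optimal prior \<nu> f \<D> D \<longleftrightarrow>
         (\<forall>i. is_arg_max (FIG_phi prior \<nu> f \<mu>) (\<lambda>d. d \<in> \<D>) (D $ i))"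
proof -
  interpret expfam_model \<D> \<Theta> \<nu> a b c1 c2 \<gamma> Z \<zeta> \<mu> f
    by (rule expfam_model.intro) (fact assms)+
  have split: "U_FIG prior \<nu> f E = (\<Sum>i\<in>UNIV. FIG_phi prior \<nu> f \<mu> (E $ i))"
    if "\<forall>i. E $ i \<in> \<D>" for E :: "real ^ 'k ^ 'n"
    using that by (intro U_FIG_eq_sum_FIG_phi prior_sets U_finite) (simp_all add: designs_def)
  show ?thesis
    using is_arg_max_sum_iff[where U = "U_FIG prior \<nu> f" and \<phi> = "FIG_phi prior \<nu> f \<mu>" and A = \<D> and D = D, OF split] D_design
    by (simp add: FIG_optimal_def designs_def)
qed

end
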